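(* For any belief $b\in\mathcal{B}$ and any finite horizons $T,T'\in\mathbb{Z}_{+}$, the following inequalities hold: $$v_{\mathrm{SMF}(T)}(b)\le v^*(b)\le\tilde z_{\mathrm{R}^{\mathrm{c}}}^{T'}(b)\le\tilde z_{\mathrm{R}}^{T'}(b),\qquad \tilde z_{\mathrm{R}^{\mathrm{c}}}^{T+1}(b)\le\tilde z_{\mathrm{R}^{\mathrm{c}}}^{T}(b).$$ In addition, $\tilde z_{\mathrm{R}}^{T}(b)$ is constant with respect to $T$, i.e. $\tilde z_{\mathrm{R}}^{T}(b)=\tilde z_{\mathrm{R}}^{0}(b)$.
   Context: **POMDP.** $\mathcal{S},\mathcal{O},\mathcal{A}$ are finite nonempty sets (states, observations, actions); $p(o|s)$ is a probability distribution on $\mathcal{O}$ for each $s$; $p(s'|s,a)$ is a probability distribution on $\mathcal{S}$ for each $(s,a)$; $r:\mathcal{S}\times\mathcal{A}\to\mathbb{R}$ is the reward; $\gamma\in[0,1)$ is the discount factor. $\mathcal{B}$ is the set of probability distributions on $\mathcal{S}$. Write $[T]=\{0,\dots,T\}$. $v_{\mathrm{MDP}}:\mathcal{S}\to\mathbb{R}$ is the unique solution of $v_{\mathrm{MDP}}(s)=\max_{a'}\big(r(s,a')+\gamma\sum_{s'}p(s'|s,a')v_{\mathrm{MDP}}(s')\big)$. **Optimal history-dependent value.** $v^*(b)=\max_\delta\mathbb{E}_\delta\big[\sum_{t=0}^\infty\gamma^tr(S_t,A_t)\,|\,S_0\sim b\big]$ over history-dependent (possibly randomized) policies: $A_0$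 is chosen knowing only $b$ (any initial observation is already incorporated in $b$), and for $t\ge1$, $A_t$ is chosen knowing $b$ and $(A_0,O_1,A_1,\dots,A_{t-1},O_t)$; here $S_{t+1}\sim p(\cdot|S_t,A_t)$ and $O_{t+1}\sim p(\cdot|S_{t+1})$. The belief is updated from $b_t$ to $b_{t+1}=f(b_t,A_t,O_{t+1})$, where $b_0=b$ and $$f(b,a,o)(\tilde s)=\frac{p(o|\tilde s)\sum_{s}p(\tilde s|s,a)b(s)}{\sum_{s,s'}p(o|s')p(s'|s,a)b(s)}.$$ **Memoryless policies.** $\Delta_{\mathrm{ml}}^T$ is the set of $\delta=(\delta^t_{a|o})_{t\in[T],a\in\mathcal{A},o\in\mathcal{O}}$ with $\delta^t_{a|o}\ge0$, $\sum_a\delta^t_{a|o}=1$; $\Delta_{\mathrm{ml}}^{T,\mathrm{d}}$ is the subset with entries in $\{0,1\}$. Under $\delta$: $O_t\sim p(\cdot|S_t)$, $A_t\sim\delta^t_{\cdot|O_t}$, $S_{t+1}\sim p(\cdot|S_t,A_t)$; $\mathbb{E}_\delta[\cdot|S_0\sim b,A_0=a]$ denotes expectation when the initial action is forced to be $a$ regardless of $O_0$. **SMF policy.** Let $$\hat Q_{\mathrm{SMF}}^T(b,a')=\max_{\delta\in\Delta_{\mathrm{ml}}^T}\mathbb{E}_\delta\Big[\sum_{t=0}^T\gamma^tr(S_t,A_t)+\gamma^{T+1}v_{\mathrm{MDP}}(S_{T+1})\Big|S_0\sim b,A_0=a'\Big].$$ An SMF policy $\delta_{\mathrm{SMF}(T)}$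 is the deterministic stationary policy which at each time $t$, given the current belief $b_t$, takes an action in $\operatorname{argmax}_{a'}\hat Q_{\mathrm{SMF}}^T(b_t,a')$ (with any fixed choice among maximizers for each belief). $v_{\mathrm{SMF}(T)}(b)$ is its expected total discounted reward over the infinite horizon starting from $S_0\sim b$, $b_0=b$. **Relaxation bounds.** For a horizon $T$, set $\tilde r_t(s,a)=\gamma^tr(s,a)$ for $t\le T-1$ and $\tilde r_T(s,a)=\gamma^Tr(s,a)+\gamma^{T+1}\sum_{s'}p(s'|s,a)v_{\mathrm{MDP}}(s')$. Consider the MILP with variables $\mu=\big((\mu_s^t)_{t\in[T+1]},(\mu_{soa}^t)_{t\in[T]},(\mu_{sa}^t)_{t\in[T]}\big)$ and $\delta$: maximize $\sum_{t=0}^T\sum_{s,a}\tilde r_t(s,a)\mu_{sa}^t$ subject to - $\delta^0_{a|o}=\delta^0_{a|o'}$ for all $o,o',a$; - $\mu_s^0=b(s)$ for all $s$; - $\mu_s^t=\sum_a\mu_{sa}^t$ for all $s$, $t\in[T]$; - $\mu_{sa}^t=\sum_o\mu_{soa}^t$ for all $s,a$, $t\in[T]$; - $\mu_s^{t+1}=\sum_{s',a'}p(s|s',a')\mu_{s'a'}^t$ for all $s$, $t\in[T]$; - $\mu_{soa}^t\le p(o|s)\mu_s^t$, $\ \mu_{soa}^t\le\delta^t_{a|o}$, $\ \mu_{soa}^t\ge p(o|s)\mu_s^t+\delta^t_{a|o}-1$ for all $s,o,a$, $t\in[T]$; - $\delta\in\Delta_{\mathrm{ml}}^{T,\mathrm{d}}$,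 $\mu\ge0$. Its linear relaxation replaces $\delta\in\Delta_{\mathrm{ml}}^{T,\mathrm{d}}$ by $\delta\in\Delta_{\mathrm{ml}}^T$; $\tilde z_{\mathrm{R}}^T(b)$ is the optimal value of this linear relaxation. $\tilde z_{\mathrm{R}^{\mathrm{c}}}^T(b)$ is the optimal value of the linear relaxation after adding nonnegative variables $\mu_{s'a'soa}^t$ ($t\in\{1,\dots,T\}$) and the constraints, for all $t\in\{1,\dots,T\}$, - $\sum_{s',a'}\mu_{s'a'soa}^t=\mu_{soa}^t$ for all $s,o,a$; - $\sum_{a}\mu_{s'a'soa}^t=p(o|s)p(s|s',a')\mu_{s'a'}^{t-1}$ for all $s',a',s,o$; - $\mu_{s'a'soa}^t=p(s|s',a',o)\sum_{\bar s}\mu_{s'a'\bar soa}^t$ for all $s',a',s,o,a$, where $p(s|s',a',o)=\dfrac{p(o|s)p(s|s',a')}{\sum_{\bar s}p(o|\bar s)p(\bar s|s',a')}$ (set to $0$ when the denominator vanishes). *)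

theory Defs
  imports "HOL-Probability.Probability"
begin

section \<open>Partially observable Markov decision processes\<close>

record ('s, 'o, 'a) pomdp =
  obs_prob :: "'s \<Rightarrow> 'o pmf"
  trans_prob :: "'s \<Rightarrow> 'a \<Rightarrow> 's pmf"
  reward :: "'s \<Rightarrow> 'a \<Rightarrow> real"
  discount :: real

definition v_MDP :: "('s::finite, 'o::finite, 'a::finite) pomdp \<Rightarrow> 's \<Rightarrow> real" where
  "v_MDP M = (THE v. \<forall>s. v s =
     (MAX a. reward M s a + discount M * (\<Sum>s'\<in>UNIV. pmf (trans_prob M s a) s' * v s')))"


section \<open>Trajectories\<close>

text \<open>A trajectory assigns to each time the triple of state, observation and action.\<close>

definition state :: "(nat \<Rightarrow> 's \<times> 'o \<times> 'a) \<Rightarrow> nat \<Rightarrow> 's" where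
  "state \<omega> t = fst (\<omega> t)"

definition obs :: "(nat \<Rightarrow> 's \<times> 'o \<times> 'a) \<Rightarrow> nat \<Rightarrow> 'o" where
  "obs \<omega> t = fst (snd (\<omega> t))"

definition action :: "(nat \<Rightarrow> 's \<times> 'o \<times> 'a) \<Rightarrow> nat \<Rightarrow> 'a" where
  "action \<omega> t = snd (snd (\<omega> t))"

text \<open>
  A decision rule \<open>d\<close> yields the distribution \<open>d t \<omega> y\<close> of the action at time \<open>t\<close>, given the
  triples \<open>\<omega> k\<close> for \<open>k < t\<close> and the observation \<open>y\<close> made at time \<open>t\<close>. Only values of \<open>\<omega>\<close>
  before \<open>t\<close> matter in the construction of the trajectory measure: the kernels are applied to
  elements of \<open>PiM {0..<t}\<close>.
\<close>

type_synonym ('s, 'o, 'a) decision_rule = "nat \<Rightarrow> (nat \<Rightarrow> 's \<times> 'o \<times> 'a) \<Rightarrow> 'o \<Rightarrow> 'a pmf"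

definition step_pmf ::
  "('s, 'o, 'a) pomdp \<Rightarrow> 's pmf \<Rightarrow> ('s, 'o, 'a) decision_rule \<Rightarrow>
   nat \<Rightarrow> (nat \<Rightarrow> 's \<times> 'o \<times> 'a) \<Rightarrow> ('s \<times> 'o \<times> 'a) pmf" where
  "step_pmf M b d t \<omega> =
     bind_pmf (if t = 0 then b else trans_prob M (state \<omega> (t - 1)) (action \<omega> (t - 1))) (\<lambda>s.
     bind_pmf (obs_prob M s) (\<lambda>y.
     map_pmf (\<lambda>a. (s, y, a)) (d t \<omega> y)))"

definition step_kernel ::
  "('s, 'o, 'a) pomdp \<Rightarrow> 's pmf \<Rightarrow> ('s, 'o, 'a) decision_rule \<Rightarrow>
   nat \<Rightarrow> (nat \<Rightarrow> 's \<times> 'o \<times> 'a) \<Rightarrow> ('s \<times> 'o \<times> 'a) measure" where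
  "step_kernel M b d t \<omega> = measure_pmf (step_pmf M b d t \<omega>)"

lemma Ionescu_Tulcea_step_kernel:
  fixes M :: "('s::finite, 'o::finite, 'a::finite) pomdp"
  shows "Ionescu_Tulcea (step_kernel M b d) (\<lambda>_. count_space UNIV)"
proof (unfold Ionescu_Tulcea_def, intro conjI allI impI)
  fix i :: nat
  have "PiM {0..<i} (\<lambda>_. count_space UNIV :: ('s \<times> 'o \<times> 'a) measure) =
        count_space (PiE {0..<i} (\<lambda>_. UNIV))"
    by (rule count_space_PiM_finite) auto
  then show "step_kernel M b d i \<in> PiM {0..<i} (\<lambda>_. count_space UNIV) \<rightarrow>\<^sub>M
               subprob_algebra (count_space UNIV)"
    by (auto simp: step_kernel_def space_subprob_algebra intro: measure_pmf.subprob_space_axioms)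
qed (simp add: step_kernel_def measure_pmf.prob_space_axioms)

text \<open>The law of the trajectory, obtained from the Ionescu-Tulcea theorem.\<close>

definition traj ::
  "('s, 'o, 'a) pomdp \<Rightarrow> 's pmf \<Rightarrow> ('s, 'o, 'a) decision_rule \<Rightarrow> (nat \<Rightarrow> 's \<times> 'o \<times> 'a) measure" where
  "traj M b d = projective_family.lim UNIV
     (Ionescu_Tulcea.CI (step_kernel M b d) (\<lambda>_. count_space UNIV)) (\<lambda>_. count_space UNIV)"

definition discounted_reward ::
  "('s, 'o, 'a) pomdp \<Rightarrow> 's pmf \<Rightarrow> ('s, 'o, 'a) decision_rule \<Rightarrow> real" where
  "discounted_reward M b d =
     (\<integral>\<omega>. (\<Sum>t. discount M ^ t * reward M (state \<omega> t) (action \<omega> t)) \<partial>traj M b d)"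


section \<open>History-dependent policies\<close>

text \<open>
  At time \<open>t\<close> a policy is given the list \<open>[(A\<^sub>0, O\<^sub>1), \<dots>, (A\<^bsub>t-1\<^esub>, O\<^sub>t)]\<close>. The trajectory measure
  also contains an observation at time 0, but no policy reads it: the initial belief is taken
  to incorporate it already.
\<close>

type_synonym ('o, 'a) policy = "('a \<times> 'o) list \<Rightarrow> 'a pmf"

definition history :: "nat \<Rightarrow> (nat \<Rightarrow> 's \<times> 'o \<times> 'a) \<Rightarrow> 'o \<Rightarrow> ('a \<times> 'o) list" where
  "history t \<omega> y = zip (map (action \<omega>) [0..<t]) (map (obs \<omega>) [1..<t] @ [y])"

definition policy_rule :: "('o, 'a) policy \<Rightarrow> ('s, 'o, 'a) decision_rule" where
  "policy_rule \<pi> = (\<lambda>t \<omega> y. \<pi> (history t \<omega> y))"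

definition policy_value :: "('s, 'o, 'a) pomdp \<Rightarrow> ('o, 'a) policy \<Rightarrow> 's pmf \<Rightarrow> real" where
  "policy_value M \<pi> b = discounted_reward M b (policy_rule \<pi>)"

text \<open>
  The policy may depend on \<open>b\<close>, because the supremum is taken separately for each \<open>b\<close>. Here and
  below, maxima over infinite sets are written as suprema; for \<open>0 \<le> discount M < 1\<close> these sets are
  nonempty and bounded, and the suprema are attained.
\<close>

definition v_star :: "('s, 'o, 'a) pomdp \<Rightarrow> 's pmf \<Rightarrow> real" where
  "v_star M b = (SUP \<pi>. policy_value M \<pi> b)"

text \<open>
  The quotient below is the probability mass function of a belief unless the observation \<open>y\<close> has
  probability 0 after \<open>a\<close>; in that case \<open>embed_pmf\<close> gives an unspecified belief, which occurs
  with probability 0 only.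
\<close>

definition belief_update ::
  "('s::finite, 'o, 'a) pomdp \<Rightarrow> 's pmf \<Rightarrow> 'a \<Rightarrow> 'o \<Rightarrow> 's pmf" where
  "belief_update M b a y = embed_pmf (\<lambda>s'.
     pmf (obs_prob M s') y * (\<Sum>s\<in>UNIV. pmf (trans_prob M s a) s' * pmf b s) /
     (\<Sum>s\<in>UNIV. \<Sum>s'\<in>UNIV. pmf (obs_prob M s') y * pmf (trans_prob M s a) s' * pmf b s))"

definition current_belief ::
  "('s::finite, 'o, 'a) pomdp \<Rightarrow> 's pmf \<Rightarrow> ('a \<times> 'o) list \<Rightarrow> 's pmf" where
  "current_belief M b h = foldl (\<lambda>\<beta> (a, y). belief_update M \<beta> a y) b h"


section \<open>Memoryless policies and the SMF policy\<close>

text \<open>Components with time index beyond \<open>T\<close> are unconstrained and irrelevant.\<close>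

definition memoryless :: "nat \<Rightarrow> (nat \<Rightarrow> 'o::finite \<Rightarrow> 'a::finite \<Rightarrow> real) set" where
  "memoryless T = {\<delta>. \<forall>t\<le>T. \<forall>y. (\<forall>a. \<delta> t y a \<ge> 0) \<and> (\<Sum>a\<in>UNIV. \<delta> t y a) = 1}"

definition memoryless_rule :: "'a \<Rightarrow> (nat \<Rightarrow> 'o \<Rightarrow> 'a \<Rightarrow> real) \<Rightarrow> ('s, 'o, 'a) decision_rule" where
  "memoryless_rule a \<delta> = (\<lambda>t \<omega> y. if t = 0 then return_pmf a else embed_pmf (\<delta> t y))"

definition Q_SMF ::
  "('s::finite, 'o::finite, 'a::finite) pomdp \<Rightarrow> nat \<Rightarrow> 's pmf \<Rightarrow> 'a \<Rightarrow> real" where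
  "Q_SMF M T b a = (SUP \<delta> \<in> memoryless T.
     (\<integral>\<omega>. (\<Sum>t\<le>T. discount M ^ t * reward M (state \<omega> t) (action \<omega> t))
           + discount M ^ (T + 1) * v_MDP M (state \<omega> (T + 1)) \<partial>traj M b (memoryless_rule a \<delta>)))"

definition SMF_selection ::
  "('s::finite, 'o::finite, 'a::finite) pomdp \<Rightarrow> nat \<Rightarrow> ('s pmf \<Rightarrow> 'a) \<Rightarrow> bool" where
  "SMF_selection M T \<sigma> \<longleftrightarrow> (\<forall>b. is_arg_max (Q_SMF M T b) (\<lambda>_. True) (\<sigma> b))"

definition belief_policy ::
  "('s::finite, 'o, 'a) pomdp \<Rightarrow> ('s pmf \<Rightarrow> 'a) \<Rightarrow> 's pmf \<Rightarrow> ('o, 'a) policy" where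
  "belief_policy M \<sigma> b = (\<lambda>h. return_pmf (\<sigma> (current_belief M b h)))"

definition v_SMF ::
  "('s::finite, 'o, 'a) pomdp \<Rightarrow> ('s pmf \<Rightarrow> 'a) \<Rightarrow> 's pmf \<Rightarrow> real" where
  "v_SMF M \<sigma> b = policy_value M (belief_policy M \<sigma> b) b"


section \<open>Linear relaxations\<close>

text \<open>
  The variables \<open>\<mu>\<^sup>t\<^sub>s\<close>, \<open>\<mu>\<^sup>t\<^bsub>soa\<^esub>\<close>, \<open>\<mu>\<^sup>t\<^bsub>sa\<^esub>\<close> and \<open>\<mu>\<^sup>t\<^bsub>s'a'soa\<^esub>\<close> are
  \<open>\<mu>S t s\<close>, \<open>\<mu>SOA t s y a\<close>, \<open>\<mu>SA t s a\<close> and \<open>\<nu> t s' a' s y a\<close>. Components outside the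
  time range of the program are unconstrained and do not enter the objective.
\<close>

definition horizon_reward ::
  "('s::finite, 'o::finite, 'a::finite) pomdp \<Rightarrow> nat \<Rightarrow> nat \<Rightarrow> 's \<Rightarrow> 'a \<Rightarrow> real" where
  "horizon_reward M T t s a =
     (if t < T then discount M ^ t * reward M s a
      else discount M ^ T * reward M s a
           + discount M ^ (T + 1) * (\<Sum>s'\<in>UNIV. pmf (trans_prob M s a) s' * v_MDP M s'))"

definition lp_objective ::
  "('s::finite, 'o::finite, 'a::finite) pomdp \<Rightarrow> nat \<Rightarrow> (nat \<Rightarrow> 's \<Rightarrow> 'a \<Rightarrow> real) \<Rightarrow> real" where
  "lp_objective M T \<mu>SA =
     (\<Sum>t\<le>T. \<Sum>s\<in>UNIV. \<Sum>a\<in>UNIV. horizon_reward M T t s a * \<mu>SA t s a)"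

definition relaxation_feasible ::
  "('s::finite, 'o::finite, 'a::finite) pomdp \<Rightarrow> nat \<Rightarrow> 's pmf \<Rightarrow>
   (nat \<Rightarrow> 's \<Rightarrow> real) \<Rightarrow> (nat \<Rightarrow> 's \<Rightarrow> 'o \<Rightarrow> 'a \<Rightarrow> real) \<Rightarrow> (nat \<Rightarrow> 's \<Rightarrow> 'a \<Rightarrow> real) \<Rightarrow>
   (nat \<Rightarrow> 'o \<Rightarrow> 'a \<Rightarrow> real) \<Rightarrow> bool" where
  "relaxation_feasible M T b \<mu>S \<mu>SOA \<mu>SA \<delta> \<longleftrightarrow>
     \<delta> \<in> memoryless T \<and>
     (\<forall>y y' a. \<delta> 0 y a = \<delta> 0 y' a) \<and>
     (\<forall>s. \<mu>S 0 s = pmf b s) \<and>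
     (\<forall>t\<le>T. \<forall>s. \<mu>S t s = (\<Sum>a\<in>UNIV. \<mu>SA t s a)) \<and>
     (\<forall>t\<le>T. \<forall>s a. \<mu>SA t s a = (\<Sum>y\<in>UNIV. \<mu>SOA t s y a)) \<and>
     (\<forall>t\<le>T. \<forall>s. \<mu>S (t + 1) s =
        (\<Sum>s'\<in>UNIV. \<Sum>a'\<in>UNIV. pmf (trans_prob M s' a') s * \<mu>SA t s' a')) \<and>
     (\<forall>t\<le>T. \<forall>s y a.
        \<mu>SOA t s y a \<le> pmf (obs_prob M s) y * \<mu>S t s \<and>
        \<mu>SOA t s y a \<le> \<delta> t y a \<and>
        \<mu>SOA t s y a \<ge> pmf (obs_prob M s) y * \<mu>S t s + \<delta> t y a - 1) \<and>
     (\<forall>t\<le>T + 1. \<forall>s. \<mu>S t s \<ge> 0) \<and>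
     (\<forall>t\<le>T. \<forall>s y a. \<mu>SOA t s y a \<ge> 0) \<and>
     (\<forall>t\<le>T. \<forall>s a. \<mu>SA t s a \<ge> 0)"

definition z_R ::
  "('s::finite, 'o::finite, 'a::finite) pomdp \<Rightarrow> nat \<Rightarrow> 's pmf \<Rightarrow> real" where
  "z_R M T b = Sup {lp_objective M T \<mu>SA | \<mu>S \<mu>SOA \<mu>SA \<delta>.
     relaxation_feasible M T b \<mu>S \<mu>SOA \<mu>SA \<delta>}"

text \<open>The value 0 for a vanishing denominator is the one given by division in \<open>real\<close>.\<close>

definition posterior_state ::
  "('s::finite, 'o, 'a) pomdp \<Rightarrow> 's \<Rightarrow> 'a \<Rightarrow> 'o \<Rightarrow> 's \<Rightarrow> real" where
  "posterior_state M s' a' y s =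
     pmf (obs_prob M s) y * pmf (trans_prob M s' a') s /
     (\<Sum>s''\<in>UNIV. pmf (obs_prob M s'') y * pmf (trans_prob M s' a') s'')"

definition cut_constraints ::
  "('s::finite, 'o::finite, 'a::finite) pomdp \<Rightarrow> nat \<Rightarrow>
   (nat \<Rightarrow> 's \<Rightarrow> 'o \<Rightarrow> 'a \<Rightarrow> real) \<Rightarrow> (nat \<Rightarrow> 's \<Rightarrow> 'a \<Rightarrow> real) \<Rightarrow>
   (nat \<Rightarrow> 's \<Rightarrow> 'a \<Rightarrow> 's \<Rightarrow> 'o \<Rightarrow> 'a \<Rightarrow> real) \<Rightarrow> bool" where
  "cut_constraints M T \<mu>SOA \<mu>SA \<nu> \<longleftrightarrow>
     (\<forall>t\<in>{1..T}.
        (\<forall>s' a' s y a. \<nu> t s' a' s y a \<ge> 0) \<and>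
        (\<forall>s y a. (\<Sum>s'\<in>UNIV. \<Sum>a'\<in>UNIV. \<nu> t s' a' s y a) = \<mu>SOA t s y a) \<and>
        (\<forall>s' a' s y. (\<Sum>a\<in>UNIV. \<nu> t s' a' s y a) =
           pmf (obs_prob M s) y * pmf (trans_prob M s' a') s * \<mu>SA (t - 1) s' a') \<and>
        (\<forall>s' a' s y a. \<nu> t s' a' s y a =
           posterior_state M s' a' y s * (\<Sum>s''\<in>UNIV. \<nu> t s' a' s'' y a)))"

definition z_Rc ::
  "('s::finite, 'o::finite, 'a::finite) pomdp \<Rightarrow> nat \<Rightarrow> 's pmf \<Rightarrow> real" where
  "z_Rc M T b = Sup {lp_objective M T \<mu>SA | \<mu>S \<mu>SOA \<mu>SA \<delta> \<nu>.
     relaxation_feasible M T b \<mu>S \<mu>SOA \<mu>SA \<delta> \<and> cut_constraints M T \<mu>SOA \<mu>SA \<nu>}"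

end

theory Submission
  imports Defs
begin

text \<open>
  All values are compared through the masses with which states, observations and actions occur
  jointly over time, and through one inequality: by the Bellman equation, playing one step and then
  collecting \<open>v_MDP\<close> is worth at most \<open>v_MDP\<close> now (\<open>expected_reward_next_state_le\<close>).
  Consequently the objective of a fixed feasible point decreases when the horizon grows
  (\<open>feasible_objective_Suc_le\<close>). A feasible point for horizon \<open>T + 1\<close> is also feasible for
  \<open>T\<close>, so \<open>z_Rc\<close> decreases in the horizon. The objective of the masses that a decision rule
  induces converges to its infinite-horizon reward, so each finite horizon bounds that reward from
  above (\<open>discounted_reward_le_objective\<close>).

  The inequalities that link \<open>\<mu>\<close> to \<open>\<delta>\<close> hold for every joint law of state, observation and
  action if \<open>\<delta>\<close> is the marginal law of the action (\<open>flow_relaxation_feasible\<close>). So even the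
  optimal policy of the fully observed problem is feasible for the plain relaxation, whose value is
  therefore \<open>v_MDP\<close> averaged over \<open>b\<close>, for every horizon (\<open>z_R_eq\<close>).

  For a history-dependent policy the joint law of two consecutive stages also satisfies the cut
  constraints: the action is chosen from the past and the current observation and is thus
  conditionally independent of the current state (\<open>lagged_flow_posterior\<close>). This gives
  \<open>v_star \<le> z_Rc\<close>. It also bounds the values of all policies, so the supremum \<open>v_star\<close>
  dominates the value of each single policy, in particular of an SMF policy. The marginals of the
  trajectory measure come from identifying it, on finite time ranges, with a composition of
  probability mass functions (\<open>distr_traj_component\<close>).
\<close>

section \<open>The Bellman equation\<close>

definition action_value ::
  "('s::finite, 'o::finite, 'a::finite) pomdp \<Rightarrow> ('s \<Rightarrow> real) \<Rightarrow> 's \<Rightarrow> 'a \<Rightarrow> real" where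
  "action_value M v s a =
     reward M s a + discount M * (\<Sum>s'\<in>UNIV. pmf (trans_prob M s a) s' * v s')"

definition bellman ::
  "('s::finite, 'o::finite, 'a::finite) pomdp \<Rightarrow> ('s \<Rightarrow> real) \<Rightarrow> 's \<Rightarrow> real" where
  "bellman M v s = (MAX a. action_value M v s a)"

lemma bellman_ge: "action_value M v s a \<le> bellman M v s"
  unfolding bellman_def by (rule Max_ge) auto

lemma bellman_attained: "\<exists>a. bellman M v s = action_value M v s a"
proof -
  have "bellman M v s \<in> range (action_value M v s)"
    unfolding bellman_def by (rule Max_in) auto
  then show ?thesis by auto
qed

lemma action_value_shift:
  assumes "0 \<le> discount M" and "\<And>s. v s \<le> w s + e"
  shows "action_value M v s a \<le> action_value M w s a + discount M * e"
proof -
  have "(\<Sum>s'\<in>UNIV. pmf (trans_prob M s a) s' * v s')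
      \<le> (\<Sum>s'\<in>UNIV. pmf (trans_prob M s a) s' * (w s' + e))"
    by (intro sum_mono mult_left_mono assms) auto
  also have "\<dots> = (\<Sum>s'\<in>UNIV. pmf (trans_prob M s a) s' * w s') + e"
    by (simp add: distrib_left sum.distrib sum_distrib_right[symmetric] sum_pmf_eq_1)
  finally show ?thesis
    using assms(1) by (simp add: action_value_def distrib_left[symmetric] mult_left_mono)
qed

lemma bellman_shift:
  assumes "0 \<le> discount M" and "\<And>s. v s \<le> w s + e"
  shows "bellman M v s \<le> bellman M w s + discount M * e"
proof -
  obtain a where "bellman M v s = action_value M v s a"
    using bellman_attained by blast
  also have "\<dots> \<le> action_value M w s a + discount M * e"
    by (rule action_value_shift[OF assms])
  also have "\<dots> \<le> bellman M w s + discount M * e"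
    by (simp add: bellman_ge)
  finally show ?thesis .
qed

lemma bellman_contraction:
  assumes "0 \<le> discount M" and "\<And>s. \<bar>v s - w s\<bar> \<le> e"
  shows "\<bar>bellman M v s - bellman M w s\<bar> \<le> discount M * e"
proof -
  have "v s \<le> w s + e" and "w s \<le> v s + e" for s
    using assms(2)[of s] by auto
  then show ?thesis
    using bellman_shift[OF assms(1), of v w e s] bellman_shift[OF assms(1), of w v e s] by auto
qed

text \<open>
  Value iteration from 0: consecutive iterates differ by at most a multiple of
  \<open>discount M ^ n\<close>, so they converge pointwise, and the contraction property carries the limit
  through the Bellman operator.
\<close>

lemma bellman_fixpoint_exists:
  fixes M :: "('s::finite, 'o::finite, 'a::finite) pomdp"
  assumes \<gamma>: "0 \<le> discount M" "discount M < 1"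
  shows "\<exists>v. \<forall>s. v s = bellman M v s"
proof -
  define u where "u n = (bellman M ^^ n) (\<lambda>_. 0)" for n
  have u_Suc: "u (Suc n) = bellman M (u n)" for n
    by (simp add: u_def)
  define D where "D = (\<Sum>s\<in>UNIV. \<bar>u 1 s - u 0 s\<bar>)"
  have step: "\<bar>u (Suc n) s - u n s\<bar> \<le> discount M ^ n * D" for n s
  proof (induction n arbitrary: s)
    case 0
    show ?case
      unfolding D_def by (simp, rule member_le_sum) auto
  next
    case (Suc n)
    then show ?case
      using bellman_contraction[OF \<gamma>(1), of "u (Suc n)" "u n"] by (simp add: u_Suc mult.assoc)
  qed
  have "convergent (\<lambda>n. u n s)" for s
  proof -
    have "summable (\<lambda>n. u (Suc n) s - u n s)"
    proof (rule summable_comparison_test')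
      show "summable (\<lambda>n. discount M ^ n * D)"
        using \<gamma> by (intro summable_mult2 summable_geometric) auto
      show "norm (u (Suc n) s - u n s) \<le> discount M ^ n * D" for n
        using step by simp
    qed
    from summable_LIMSEQ[OF this]
    have "(\<lambda>n. u n s - u 0 s) \<longlonglongrightarrow> (\<Sum>n. u (Suc n) s - u n s)"
      by (simp only: sum_lessThan_telescope[of "\<lambda>n. u n s"])
    then have "(\<lambda>n. (u n s - u 0 s) + u 0 s) \<longlonglongrightarrow> (\<Sum>n. u (Suc n) s - u n s) + u 0 s"
      by (intro tendsto_intros)
    then show ?thesis
      by (auto simp: convergent_def)
  qed
  then obtain v where v: "\<And>s. (\<lambda>n. u n s) \<longlonglongrightarrow> v s"
    unfolding convergent_def by metis
  have "v s = bellman M v s" for s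
  proof (rule LIMSEQ_unique)
    show "(\<lambda>n. u (Suc n) s) \<longlonglongrightarrow> v s"
      using v by (rule LIMSEQ_Suc)
  \<comment> \<open>Since there are finitely many states, the \<open>\<ell>\<^sub>1\<close> distance is a convenient bound
  for the maximum distance that also tends to 0.\<close>
    have "(\<lambda>n. \<Sum>s'\<in>UNIV. \<bar>u n s' - v s'\<bar>) \<longlonglongrightarrow> (\<Sum>s'\<in>UNIV. \<bar>v s' - v s'\<bar>)"
      by (intro tendsto_intros v)
    then have "(\<lambda>n. discount M * (\<Sum>s'\<in>UNIV. \<bar>u n s' - v s'\<bar>)) \<longlonglongrightarrow> 0"
      by (auto intro: tendsto_mult_right_zero)
    moreover have "norm (u (Suc n) s - bellman M v s)
        \<le> discount M * (\<Sum>s'\<in>UNIV. \<bar>u n s' - v s'\<bar>)" for n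
      unfolding u_Suc real_norm_def
      by (intro bellman_contraction[OF \<gamma>(1)] member_le_sum) auto
    ultimately have "(\<lambda>n. u (Suc n) s - bellman M v s) \<longlonglongrightarrow> 0"
      by (rule Lim_null_comparison[OF always_eventually[OF allI], rotated])
    then show "(\<lambda>n. u (Suc n) s) \<longlonglongrightarrow> bellman M v s"
      by (simp add: LIM_zero_iff)
  qed
  then show ?thesis by blast
qed

lemma bellman_fixpoint_unique:
  fixes M :: "('s::finite, 'o::finite, 'a::finite) pomdp" and v w :: "'s \<Rightarrow> real"
  assumes \<gamma>: "0 \<le> discount M" "discount M < 1"
    and v: "\<forall>s. v s = bellman M v s" and w: "\<forall>s. w s = bellman M w s"
  shows "v = w"
proof -
  define e where "e = (MAX s. \<bar>v s - w s\<bar>)"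
  have e: "\<bar>v s - w s\<bar> \<le> e" for s
    unfolding e_def by (rule Max_ge) auto
  have "e \<in> range (\<lambda>s. \<bar>v s - w s\<bar>)"
    unfolding e_def by (rule Max_in) auto
  then obtain s where s: "e = \<bar>v s - w s\<bar>" by auto
  also have "\<dots> = \<bar>bellman M v s - bellman M w s\<bar>"
    by (rule arg_cong2[where f="\<lambda>x y. \<bar>x - y\<bar>"]) (use v w in blast)+
  also have "\<dots> \<le> discount M * e"
    by (rule bellman_contraction[OF \<gamma>(1) e])
  finally have "(1 - discount M) * e \<le> 0"
    by (simp add: algebra_simps)
  then have "e \<le> 0"
    using \<gamma>(2) by (simp add: mult_le_0_iff)
  then have "v s = w s" for s
    using e[of s] by simp
  then show ?thesis by auto
qed

lemma v_MDP_bellman: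
  assumes "0 \<le> discount M" and "discount M < 1"
  shows "v_MDP M s = bellman M (v_MDP M) s"
proof -
  have "\<exists>!v. \<forall>s. v s = bellman M v s"
    using bellman_fixpoint_exists[OF assms] bellman_fixpoint_unique[OF assms] by blast
  then have fixpoint: "\<forall>s. (THE v. \<forall>s. v s = bellman M v s) s = bellman M (THE v. \<forall>s. v s = bellman M v s) s"
    by (rule theI')
  have eq: "v_MDP M = (THE v. \<forall>s. v s = bellman M v s)"
    unfolding v_MDP_def bellman_def action_value_def ..
  show ?thesis
    unfolding eq by (rule fixpoint[THEN spec])
qed

section \<open>Objective values and the horizon\<close>

definition expected_reward ::
  "('s::finite, 'o::finite, 'a::finite) pomdp \<Rightarrow> ('s \<Rightarrow> 'a \<Rightarrow> real) \<Rightarrow> real" where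
  "expected_reward M m = (\<Sum>s\<in>UNIV. \<Sum>a\<in>UNIV. m s a * reward M s a)"

text \<open>
  The image of a mass distribution on state-action pairs under the transition probabilities.
\<close>

definition next_state ::
  "('s::finite, 'o::finite, 'a::finite) pomdp \<Rightarrow> ('s \<Rightarrow> 'a \<Rightarrow> real) \<Rightarrow> 's \<Rightarrow> real" where
  "next_state M m s = (\<Sum>s'\<in>UNIV. \<Sum>a'\<in>UNIV. pmf (trans_prob M s' a') s * m s' a')"

lemma sum_next_state:
  "(\<Sum>s\<in>UNIV. next_state M m s * v s)
     = (\<Sum>s\<in>UNIV. \<Sum>a\<in>UNIV. m s a * (\<Sum>s'\<in>UNIV. pmf (trans_prob M s a) s' * v s'))"
proof -
  let ?f = "\<lambda>s s' a'. m s' a' * (pmf (trans_prob M s' a') s * v s)"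
  have "(\<Sum>s\<in>UNIV. next_state M m s * v s) = (\<Sum>s\<in>UNIV. \<Sum>s'\<in>UNIV. \<Sum>a'\<in>UNIV. ?f s s' a')"
    by (simp add: next_state_def sum_distrib_left sum_distrib_right mult_ac)
  also have "\<dots> = (\<Sum>s'\<in>UNIV. \<Sum>s\<in>UNIV. \<Sum>a'\<in>UNIV. ?f s s' a')"
    by (rule sum.swap)
  also have "\<dots> = (\<Sum>s'\<in>UNIV. \<Sum>a'\<in>UNIV. \<Sum>s\<in>UNIV. ?f s s' a')"
    by (intro sum.cong refl sum.swap)
  finally show ?thesis
    by (simp add: sum_distrib_left)
qed

lemma expected_reward_next_state:
  "expected_reward M m + discount M * (\<Sum>s\<in>UNIV. next_state M m s * v s)
     = (\<Sum>s\<in>UNIV. \<Sum>a\<in>UNIV. m s a * action_value M v s a)"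
proof -
  have "m s a * action_value M v s a = m s a * reward M s a
      + discount M * (m s a * (\<Sum>s'\<in>UNIV. pmf (trans_prob M s a) s' * v s'))" for s a
    by (simp add: action_value_def algebra_simps)
  then show ?thesis
    by (simp only: sum_next_state expected_reward_def sum.distrib sum_distrib_left[symmetric])
qed

text \<open>
  The Bellman inequality averaged over \<open>m\<close>: acting once according to \<open>m\<close> and continuing with
  \<open>v_MDP\<close> earns at most \<open>v_MDP\<close> of the current state. This single inequality is the source of every
  comparison between different horizons.
\<close>

lemma expected_reward_next_state_le:
  assumes \<gamma>: "0 \<le> discount M" "discount M < 1" and "\<And>s a. 0 \<le> m s a"
  shows "expected_reward M m + discount M * (\<Sum>s\<in>UNIV. next_state M m s * v_MDP M s)
    \<le> (\<Sum>s\<in>UNIV. (\<Sum>a\<in>UNIV. m s a) * v_MDP M s)"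
  unfolding expected_reward_next_state sum_distrib_right
proof (intro sum_mono mult_left_mono assms)
  show "action_value M (v_MDP M) s a \<le> v_MDP M s" for s a
    using bellman_ge[of M "v_MDP M" s a] v_MDP_bellman[OF \<gamma>, of s] by linarith
qed

text \<open>
  The terminal term of the last stage reward is \<open>v_MDP\<close> averaged over the state distribution one step
  after the horizon, so the objective is a truncated reward series plus a discounted remainder.
\<close>

lemma lp_objective_eq:
  "lp_objective M T m = (\<Sum>t\<le>T. discount M ^ t * expected_reward M (m t))
     + discount M ^ Suc T * (\<Sum>s\<in>UNIV. next_state M (m T) s * v_MDP M s)"
proof -
  let ?v = "v_MDP M"
  have "lp_objective M T m
     = (\<Sum>t<T. \<Sum>s\<in>UNIV. \<Sum>a\<in>UNIV. horizon_reward M T t s a * m t s a)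
       + (\<Sum>s\<in>UNIV. \<Sum>a\<in>UNIV. horizon_reward M T T s a * m T s a)"
    by (simp add: lp_objective_def lessThan_Suc_atMost[symmetric])
  also have "(\<Sum>t<T. \<Sum>s\<in>UNIV. \<Sum>a\<in>UNIV. horizon_reward M T t s a * m t s a)
      = (\<Sum>t<T. discount M ^ t * expected_reward M (m t))"
    by (simp add: horizon_reward_def expected_reward_def sum_distrib_left mult_ac)
  also have "(\<Sum>s\<in>UNIV. \<Sum>a\<in>UNIV. horizon_reward M T T s a * m T s a)
      = discount M ^ T * expected_reward M (m T)
        + discount M ^ Suc T * (\<Sum>s\<in>UNIV. next_state M (m T) s * ?v s)"
  proof -
    have "horizon_reward M T T s a * m T s a = discount M ^ T * (m T s a * reward M s a)
      + discount M ^ Suc T * (m T s a * (\<Sum>s'\<in>UNIV. pmf (trans_prob M s a) s' * ?v s'))" for s a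
      by (simp add: horizon_reward_def algebra_simps)
    then show ?thesis
      by (simp only: sum_next_state expected_reward_def sum.distrib sum_distrib_left[symmetric])
  qed
  finally show ?thesis
    by (simp add: lessThan_Suc_atMost[symmetric])
qed

lemma lp_objective_0_le:
  assumes \<gamma>: "0 \<le> discount M" "discount M < 1" and "\<And>s a. 0 \<le> m 0 s a"
  shows "lp_objective M 0 m \<le> (\<Sum>s\<in>UNIV. (\<Sum>a\<in>UNIV. m 0 s a) * v_MDP M s)"
  using expected_reward_next_state_le[OF \<gamma>, of "m 0"] assms(3) by (simp add: lp_objective_eq)

text \<open>
  Lengthening the horizon replaces the terminal value \<open>v_MDP\<close> by one real step followed by
  \<open>v_MDP\<close>, which by the Bellman inequality cannot be better.
\<close>

lemma lp_objective_Suc_le: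
  assumes \<gamma>: "0 \<le> discount M" "discount M < 1"
    and nonneg: "\<And>s a. 0 \<le> m (Suc T) s a"
    and flow: "\<And>s. (\<Sum>a\<in>UNIV. m (Suc T) s a) = next_state M (m T) s"
  shows "lp_objective M (Suc T) m \<le> lp_objective M T m"
proof -
  have "discount M ^ Suc T * (expected_reward M (m (Suc T))
           + discount M * (\<Sum>s\<in>UNIV. next_state M (m (Suc T)) s * v_MDP M s))
       \<le> discount M ^ Suc T * (\<Sum>s\<in>UNIV. next_state M (m T) s * v_MDP M s)"
    using expected_reward_next_state_le[OF \<gamma>, of "m (Suc T)"] nonneg
    by (intro mult_left_mono) (auto simp: flow \<gamma>)
  then show ?thesis
    by (simp add: lp_objective_eq distrib_left mult_ac)
qed

lemma relaxation_feasible_Suc: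
  fixes M :: "('s::finite, 'o::finite, 'a::finite) pomdp"
  assumes "relaxation_feasible M (Suc T) b \<mu>S \<mu>SOA \<mu>SA \<delta>"
  shows "relaxation_feasible M T b \<mu>S \<mu>SOA \<mu>SA \<delta>"
proof -
  have "memoryless (Suc T) \<subseteq> (memoryless T :: (nat \<Rightarrow> 'o \<Rightarrow> 'a \<Rightarrow> real) set)"
    unfolding memoryless_def using le_SucI by blast
  moreover have "T + 1 \<le> Suc T + 1" by simp
  ultimately show ?thesis
    using assms unfolding relaxation_feasible_def by (meson le_SucI order_trans subsetD)
qed

text \<open>
  The constraints on \<open>\<mu>\<close> that a comparison of objective values rests on; they describe an ordinary
  MDP in which actions may depend on the state.
\<close>

lemma relaxation_feasible_state_action:
  assumes "relaxation_feasible M T b \<mu>S \<mu>SOA \<mu>SA \<delta>"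
  shows "\<mu>S 0 s = pmf b s"
    and "t \<le> T \<Longrightarrow> 0 \<le> \<mu>SA t s a"
    and "t \<le> T \<Longrightarrow> \<mu>S t s = (\<Sum>a\<in>UNIV. \<mu>SA t s a)"
    and "t \<le> T \<Longrightarrow> \<mu>S (Suc t) s = next_state M (\<mu>SA t) s"
proof -
  have "\<forall>s. \<mu>S 0 s = pmf b s"
    using assms unfolding relaxation_feasible_def by (elim conjE)
  then show "\<mu>S 0 s = pmf b s" ..
  have "\<forall>t\<le>T. \<forall>s a. 0 \<le> \<mu>SA t s a"
    using assms unfolding relaxation_feasible_def by (elim conjE)
  then show "t \<le> T \<Longrightarrow> 0 \<le> \<mu>SA t s a" by blast
  have "\<forall>t\<le>T. \<forall>s. \<mu>S t s = (\<Sum>a\<in>UNIV. \<mu>SA t s a)"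
    using assms unfolding relaxation_feasible_def by (elim conjE)
  then show "t \<le> T \<Longrightarrow> \<mu>S t s = (\<Sum>a\<in>UNIV. \<mu>SA t s a)" by blast
  have "\<forall>t\<le>T. \<forall>s. \<mu>S (t + 1) s =
      (\<Sum>s'\<in>UNIV. \<Sum>a'\<in>UNIV. pmf (trans_prob M s' a') s * \<mu>SA t s' a')"
    using assms unfolding relaxation_feasible_def by (elim conjE)
  then show "t \<le> T \<Longrightarrow> \<mu>S (Suc t) s = next_state M (\<mu>SA t) s"
    by (simp add: next_state_def)
qed

lemma feasible_objective_Suc_le:
  assumes \<gamma>: "0 \<le> discount M" "discount M < 1"
    and feas: "relaxation_feasible M (Suc T) b \<mu>S \<mu>SOA \<mu>SA \<delta>"
  shows "lp_objective M (Suc T) \<mu>SA \<le> lp_objective M T \<mu>SA"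
proof (rule lp_objective_Suc_le[OF \<gamma>])
  note rel = relaxation_feasible_state_action[OF feas]
  show "0 \<le> \<mu>SA (Suc T) s a" for s a
    by (rule rel) simp
  have "T \<le> Suc T" by simp
  from rel(3)[OF order_refl] rel(4)[OF this]
  show "(\<Sum>a\<in>UNIV. \<mu>SA (Suc T) s a) = next_state M (\<mu>SA T) s" for s
    by metis
qed

text \<open>
  Shortening the horizon step by step down to 0 only increases the objective, and at horizon 0 the
  averaged Bellman inequality applies to the initial belief.
\<close>

lemma feasible_objective_le:
  assumes \<gamma>: "0 \<le> discount M" "discount M < 1"
    and feas: "relaxation_feasible M T b \<mu>S \<mu>SOA \<mu>SA \<delta>"
  shows "lp_objective M T \<mu>SA \<le> (\<Sum>s\<in>UNIV. pmf b s * v_MDP M s)"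
  using feas
proof (induction T)
  case 0
  note rel = relaxation_feasible_state_action[OF 0]
  have "(\<Sum>a\<in>UNIV. \<mu>SA 0 s a) = pmf b s" for s
    using rel(3)[OF order_refl, of s] unfolding rel(1) by (rule sym)
  then show ?case
    using lp_objective_0_le[OF \<gamma>, of \<mu>SA] rel(2)[of 0] by simp
next
  case (Suc T)
  show ?case
    using feasible_objective_Suc_le[OF \<gamma> Suc.prems] Suc.IH[OF relaxation_feasible_Suc[OF Suc.prems]]
    by (rule order_trans)
qed

section \<open>Flows of probability mass\<close>

definition obs_marginal :: "('s \<Rightarrow> 'o::finite \<Rightarrow> 'a \<Rightarrow> real) \<Rightarrow> 's \<Rightarrow> 'a \<Rightarrow> real" where
  "obs_marginal q s a = (\<Sum>y\<in>UNIV. q s y a)"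

text \<open>
  A flow gives the joint masses of state, observation and action at each time for a process that
  starts in \<open>b\<close>, moves by the transition probabilities and emits observations by the observation
  probabilities. How actions are chosen is left open; in particular they may depend on the state.
\<close>

definition flow ::
  "('s::finite, 'o::finite, 'a::finite) pomdp \<Rightarrow> 's pmf \<Rightarrow> (nat \<Rightarrow> 's \<Rightarrow> 'o \<Rightarrow> 'a \<Rightarrow> real) \<Rightarrow> bool" where
  "flow M b q \<longleftrightarrow> (\<forall>t s y a. 0 \<le> q t s y a) \<and>
     (\<forall>s y. (\<Sum>a\<in>UNIV. q 0 s y a) = pmf (obs_prob M s) y * pmf b s) \<and>
     (\<forall>t s y. (\<Sum>a\<in>UNIV. q (Suc t) s y a)
        = pmf (obs_prob M s) y * next_state M (obs_marginal (q t)) s)"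

lemma sum_obs_marginal: "(\<Sum>a\<in>UNIV. obs_marginal q s a) = (\<Sum>y\<in>UNIV. \<Sum>a\<in>UNIV. q s y a)"
  unfolding obs_marginal_def by (rule sum.swap)

lemma flow_0:
  assumes "flow M b q" shows "(\<Sum>a\<in>UNIV. obs_marginal (q 0) s a) = pmf b s"
  using assms by (simp add: flow_def sum_obs_marginal sum_distrib_right[symmetric] sum_pmf_eq_1)

lemma flow_Suc:
  assumes "flow M b q"
  shows "(\<Sum>a\<in>UNIV. obs_marginal (q (Suc t)) s a) = next_state M (obs_marginal (q t)) s"
  using assms by (simp add: flow_def sum_obs_marginal sum_distrib_right[symmetric] sum_pmf_eq_1)

lemma flow_observation:
  assumes "flow M b q"
  shows "(\<Sum>a\<in>UNIV. q t s y a) = pmf (obs_prob M s) y * (\<Sum>a\<in>UNIV. obs_marginal (q t) s a)"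
  using assms by (cases t) (simp_all only: flow_0[OF assms] flow_Suc[OF assms], simp_all add: flow_def)

lemma flow_total:
  assumes "flow M b q"
  shows "(\<Sum>s\<in>UNIV. \<Sum>a\<in>UNIV. obs_marginal (q t) s a) = 1"
proof (induction t)
  case 0
  show ?case by (simp add: flow_0[OF assms] sum_pmf_eq_1)
next
  case (Suc t)
  then show ?case
    using sum_next_state[of M "obs_marginal (q t)" "\<lambda>_. 1"]
    by (simp add: flow_Suc[OF assms] sum_pmf_eq_1)
qed

text \<open>
  The constraints that couple \<open>\<mu>\<close> to \<open>\<delta>\<close> are so weak that the marginal law \<open>p t\<close> of the action,
  used for every observation, always satisfies them. At time \<open>t\<close>, the event that \<open>s\<close>, \<open>y\<close>, \<open>a\<close> occur has
  probability at most \<open>p t a\<close>, and the event that \<open>s\<close>, \<open>y\<close> occur with an action other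
  than \<open>a\<close> has probability at most \<open>1 - p t a\<close>; these are the upper and the lower bound. As
  \<open>p t\<close> ignores the observation, the constraint on \<open>\<delta>\<close> at time 0 holds too.
\<close>

lemma flow_relaxation_feasible:
  fixes M :: "('s::finite, 'o::finite, 'a::finite) pomdp"
  assumes q: "flow M b q"
  shows "relaxation_feasible M T b (\<lambda>t s. \<Sum>a\<in>UNIV. obs_marginal (q t) s a) q
           (\<lambda>t. obs_marginal (q t)) (\<lambda>t y a. \<Sum>s\<in>UNIV. obs_marginal (q t) s a)"
proof -
  define \<mu>S where "\<mu>S t s = (\<Sum>a\<in>UNIV. obs_marginal (q t) s a)" for t s
  define p where "p t a = (\<Sum>s\<in>UNIV. obs_marginal (q t) s a)" for t a
  have q_nonneg: "0 \<le> q t s y a" for t s y a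
    using q by (simp add: flow_def)
  have m_nonneg: "0 \<le> obs_marginal (q t) s a" for t s a
    by (simp add: obs_marginal_def sum_nonneg q_nonneg)
  have p_sum: "(\<Sum>a\<in>UNIV. p t a) = 1" for t
    using flow_total[OF q, of t] unfolding p_def by (subst sum.swap)
  have q_le_p: "q t s y a \<le> p t a" for t s y a
  proof -
    have "q t s y a \<le> obs_marginal (q t) s a"
      unfolding obs_marginal_def by (rule member_le_sum) (auto simp: q_nonneg)
    also have "\<dots> \<le> p t a"
      unfolding p_def by (rule member_le_sum) (auto simp: m_nonneg)
    finally show ?thesis .
  qed
  have q_obs: "(\<Sum>a\<in>UNIV. q t s y a) = pmf (obs_prob M s) y * \<mu>S t s" for t s y
    unfolding \<mu>S_def by (rule flow_observation[OF q])
  have upper: "q t s y a \<le> pmf (obs_prob M s) y * \<mu>S t s" for t s y a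
    unfolding q_obs[symmetric] by (rule member_le_sum) (auto simp: q_nonneg)
  have lower: "pmf (obs_prob M s) y * \<mu>S t s + p t a - 1 \<le> q t s y a" for t s y a
  proof -
    have "(\<Sum>a'\<in>UNIV - {a}. q t s y a') \<le> (\<Sum>a'\<in>UNIV - {a}. p t a')"
      by (intro sum_mono q_le_p)
    moreover have "(\<Sum>a'\<in>UNIV. q t s y a') = q t s y a + (\<Sum>a'\<in>UNIV - {a}. q t s y a')"
      by (rule sum.remove) auto
    moreover have "(\<Sum>a'\<in>UNIV. p t a') = p t a + (\<Sum>a'\<in>UNIV - {a}. p t a')"
      by (rule sum.remove) auto
    ultimately show ?thesis
      by (simp add: q_obs p_sum)
  qed
  have "(\<lambda>t y. p t) \<in> memoryless T"
    using m_nonneg p_sum by (auto simp: memoryless_def p_def intro!: sum_nonneg)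
  then have "relaxation_feasible M T b \<mu>S q (\<lambda>t. obs_marginal (q t)) (\<lambda>t y. p t)"
    unfolding relaxation_feasible_def
    using upper lower q_le_p q_nonneg m_nonneg flow_0[OF q] flow_Suc[OF q]
    by (auto simp: \<mu>S_def obs_marginal_def next_state_def sum_nonneg)
  then show ?thesis
    by (simp add: \<mu>S_def[abs_def] p_def[abs_def])
qed

section \<open>The flow of the fully observed problem\<close>

lemma exists_greedy: "\<exists>g. \<forall>s. bellman M v s = action_value M v s (g s)"
  by (intro choice allI bellman_attained)

text \<open>
  The state distribution when a stationary policy \<open>g\<close> acts with full knowledge of the state.
\<close>

primrec control_state ::
  "('s::finite, 'o::finite, 'a::finite) pomdp \<Rightarrow> 's pmf \<Rightarrow> ('s \<Rightarrow> 'a) \<Rightarrow> nat \<Rightarrow> 's \<Rightarrow> real" where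
  "control_state M b g 0 = pmf b"
| "control_state M b g (Suc t) =
     next_state M (\<lambda>s a. if a = g s then control_state M b g t s else 0)"

definition control_flow ::
  "('s::finite, 'o::finite, 'a::finite) pomdp \<Rightarrow> 's pmf \<Rightarrow> ('s \<Rightarrow> 'a) \<Rightarrow> nat \<Rightarrow> 's \<Rightarrow> 'o \<Rightarrow> 'a \<Rightarrow> real" where
  "control_flow M b g t s y a =
     (if a = g s then pmf (obs_prob M s) y * control_state M b g t s else 0)"

lemma obs_marginal_control_flow:
  "obs_marginal (control_flow M b g t) s a = (if a = g s then control_state M b g t s else 0)"
  by (simp add: obs_marginal_def control_flow_def sum_distrib_right[symmetric] sum_pmf_eq_1)

lemma control_state_nonneg: "0 \<le> control_state M b g t s"
  by (induction t arbitrary: s) (auto simp: next_state_def intro!: sum_nonneg)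

lemma flow_control_flow: "flow M b (control_flow M b g)"
  unfolding flow_def
proof (intro conjI allI)
  show "0 \<le> control_flow M b g t s y a" for t s y a
    by (simp add: control_flow_def control_state_nonneg)
  show "(\<Sum>a\<in>UNIV. control_flow M b g 0 s y a) = pmf (obs_prob M s) y * pmf b s" for s y
    by (simp add: control_flow_def)
  have "obs_marginal (control_flow M b g t) = (\<lambda>s a. if a = g s then control_state M b g t s else 0)" for t
    by (simp add: obs_marginal_control_flow fun_eq_iff)
  then show "(\<Sum>a\<in>UNIV. control_flow M b g (Suc t) s y a)
     = pmf (obs_prob M s) y * next_state M (obs_marginal (control_flow M b g t)) s" for t s y
    by (simp add: control_flow_def)
qed

text \<open>
  A greedy policy turns the averaged Bellman inequality into an equality, so the objective keeps the
  same value for every horizon.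
\<close>

lemma lp_objective_greedy:
  assumes \<gamma>: "0 \<le> discount M" "discount M < 1"
    and g: "\<And>s. bellman M (v_MDP M) s = action_value M (v_MDP M) s (g s)"
  shows "lp_objective M T (\<lambda>t. obs_marginal (control_flow M b g t)) = (\<Sum>s\<in>UNIV. pmf b s * v_MDP M s)"
proof (induction T)
  define m where "m t = obs_marginal (control_flow M b g t)" for t
  have "m t s a * action_value M (v_MDP M) s a = m t s a * v_MDP M s" for t s a
    using g[of s] v_MDP_bellman[OF \<gamma>, of s] by (simp add: m_def obs_marginal_control_flow)
  then have eq: "expected_reward M (m t) + discount M * (\<Sum>s\<in>UNIV. next_state M (m t) s * v_MDP M s)
      = (\<Sum>s\<in>UNIV. (\<Sum>a\<in>UNIV. m t s a) * v_MDP M s)" for t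
    by (simp only: expected_reward_next_state sum_distrib_right)
  note fl = flow_control_flow[of M b g]
  {
    case 0
    show ?case
      using eq[of 0] flow_0[OF fl] by (simp add: lp_objective_eq m_def)
  next
    case (Suc T)
    have "lp_objective M (Suc T) m = (\<Sum>t\<le>T. discount M ^ t * expected_reward M (m t))
        + discount M ^ Suc T * (expected_reward M (m (Suc T))
           + discount M * (\<Sum>s\<in>UNIV. next_state M (m (Suc T)) s * v_MDP M s))"
      by (simp add: lp_objective_eq distrib_left mult_ac)
    also have "\<dots> = lp_objective M T m"
      unfolding eq using flow_Suc[OF fl] by (simp add: lp_objective_eq m_def)
    finally show ?case
      using Suc by (simp add: m_def[abs_def])
  }
qed

section \<open>Values of the relaxations\<close>

text \<open>
  The linear relaxation loses all information about partial observability: its value is that of the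
  fully observed problem. Attainment comes from the flow of a greedy state-feedback policy.
\<close>

lemma z_R_eq:
  assumes \<gamma>: "0 \<le> discount M" "discount M < 1"
  shows "z_R M T b = (\<Sum>s\<in>UNIV. pmf b s * v_MDP M s)"
  unfolding z_R_def
proof (rule cSup_eq_maximum)
  obtain g where g: "\<And>s. bellman M (v_MDP M) s = action_value M (v_MDP M) s (g s)"
    using exists_greedy by metis
  show "(\<Sum>s\<in>UNIV. pmf b s * v_MDP M s) \<in> {lp_objective M T \<mu>SA | \<mu>S \<mu>SOA \<mu>SA \<delta>.
     relaxation_feasible M T b \<mu>S \<mu>SOA \<mu>SA \<delta>}"
    using lp_objective_greedy[OF \<gamma> g, symmetric]
      flow_relaxation_feasible[OF flow_control_flow] by blast
  show "x \<le> (\<Sum>s\<in>UNIV. pmf b s * v_MDP M s)" if "x \<in> {lp_objective M T \<mu>SA | \<mu>S \<mu>SOA \<mu>SA \<delta>.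
     relaxation_feasible M T b \<mu>S \<mu>SOA \<mu>SA \<delta>}" for x
    using that feasible_objective_le[OF \<gamma>] by blast
qed

lemma z_Rc_ge:
  assumes \<gamma>: "0 \<le> discount M" "discount M < 1"
    and "relaxation_feasible M T b \<mu>S \<mu>SOA \<mu>SA \<delta>" "cut_constraints M T \<mu>SOA \<mu>SA \<nu>"
  shows "lp_objective M T \<mu>SA \<le> z_Rc M T b"
  unfolding z_Rc_def
proof (rule cSup_upper)
  show "bdd_above {lp_objective M T \<mu>SA | \<mu>S \<mu>SOA \<mu>SA \<delta> \<nu>.
     relaxation_feasible M T b \<mu>S \<mu>SOA \<mu>SA \<delta> \<and> cut_constraints M T \<mu>SOA \<mu>SA \<nu>}"
    using feasible_objective_le[OF \<gamma>, of T b] by (auto intro!: bdd_aboveI)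
qed (use assms in blast)

section \<open>Finite-dimensional laws of a trajectory\<close>

text \<open>
  The law of the first \<open>n\<close> triples. Entries from \<open>n\<close> on are \<open>undefined\<close>, as in the extensional
  functions on which the kernels of the Ionescu-Tulcea construction act.
\<close>

primrec prefix_law ::
  "('s, 'o, 'a) pomdp \<Rightarrow> 's pmf \<Rightarrow> ('s, 'o, 'a) decision_rule \<Rightarrow> nat \<Rightarrow> (nat \<Rightarrow> 's \<times> 'o \<times> 'a) pmf" where
  "prefix_law M b d 0 = return_pmf (\<lambda>_. undefined)"
| "prefix_law M b d (Suc n) =
     bind_pmf (prefix_law M b d n) (\<lambda>\<omega>. map_pmf (\<lambda>x. fun_upd \<omega> n x) (step_pmf M b d n \<omega>))"

definition stage_law ::
  "('s, 'o, 'a) pomdp \<Rightarrow> 's pmf \<Rightarrow> ('s, 'o, 'a) decision_rule \<Rightarrow> nat \<Rightarrow> ('s \<times> 'o \<times> 'a) pmf" where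
  "stage_law M b d t = bind_pmf (prefix_law M b d t) (step_pmf M b d t)"

lemma stage_law_eq_map_prefix_law: "map_pmf (\<lambda>\<omega>. \<omega> t) (prefix_law M b d (Suc t)) = stage_law M b d t"
  by (simp add: stage_law_def map_bind_pmf map_pmf_comp)

text \<open>
  All finite product spaces involved are discrete, so every function is measurable, and the kernel
  composition of the Ionescu-Tulcea construction agrees with monadic composition of mass functions.
\<close>

lemma nn_integral_Ionescu_Tulcea_C:
  fixes M :: "('s::finite, 'o::finite, 'a::finite) pomdp" and f :: "(nat \<Rightarrow> 's \<times> 'o \<times> 'a) \<Rightarrow> ennreal"
  shows "(\<integral>\<^sup>+\<omega>. f \<omega> \<partial>Ionescu_Tulcea.C (step_kernel M b d) (\<lambda>_. count_space UNIV) 0 n (\<lambda>_. undefined))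
    = (\<integral>\<^sup>+\<omega>. f \<omega> \<partial>measure_pmf (prefix_law M b d n))"
proof -
  let ?N = "\<lambda>_::nat. count_space (UNIV :: ('s \<times> 'o \<times> 'a) set)"
  interpret Ionescu_Tulcea "step_kernel M b d" ?N
    by (rule Ionescu_Tulcea_step_kernel)
  have PiM_eq: "PiM {0..<n} ?N = count_space (PiE {0..<n} (\<lambda>_. UNIV))" for n
    by (rule count_space_PiM_finite) auto
  have meas: "f \<in> borel_measurable (PiM {0..<n} ?N)" for f :: "(nat \<Rightarrow> 's \<times> 'o \<times> 'a) \<Rightarrow> ennreal" and n
    by (simp add: PiM_eq)
  have start: "(\<lambda>_. undefined) \<in> space (PiM {0..<0::nat} ?N)"
    by (simp add: space_PiM)
  show ?thesis
  proof (induction n arbitrary: f)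
    case 0
    show ?case
      using start meas[of f 0] by (simp add: nn_integral_return)
  next
    case (Suc n)
    have "(\<integral>\<^sup>+\<omega>. f \<omega> \<partial>C 0 (Suc n) (\<lambda>_. undefined))
        = (\<integral>\<^sup>+\<omega>. (\<integral>\<^sup>+\<omega>'. f \<omega>' \<partial>eP n \<omega>) \<partial>C 0 n (\<lambda>_. undefined))"
      using measurable_eP[of n] meas[of f "Suc n"]
      by (simp, subst nn_integral_bind[where B="PiM {0..<Suc n} ?N"])
         (auto simp: measurable_cong_sets[OF sets_C[OF start, of n] refl])
    also have "\<dots> = (\<integral>\<^sup>+\<omega>. (\<integral>\<^sup>+x. f (fun_upd \<omega> n x) \<partial>step_pmf M b d n \<omega>) \<partial>C 0 n (\<lambda>_. undefined))"
      using meas[of f "Suc n"] start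
      by (intro nn_integral_cong) (simp add: space_C nn_integral_eP step_kernel_def)
    also have "\<dots> = (\<integral>\<^sup>+\<omega>. f \<omega> \<partial>prefix_law M b d (Suc n))"
      by (simp add: Suc nn_integral_bind_pmf nn_integral_map_pmf)
    finally show ?case .
  qed
qed

lemma sets_traj:
  fixes M :: "('s::finite, 'o::finite, 'a::finite) pomdp"
  shows "sets (traj M b d) = sets (PiM UNIV (\<lambda>_. count_space UNIV))"
proof -
  interpret Ionescu_Tulcea "step_kernel M b d" "\<lambda>_. count_space UNIV"
    by (rule Ionescu_Tulcea_step_kernel)
  show ?thesis
    unfolding traj_def by simp
qed

lemma measurable_traj_component:
  fixes M :: "('s::finite, 'o::finite, 'a::finite) pomdp"
  shows "(\<lambda>\<omega>. \<omega> t) \<in> traj M b d \<rightarrow>\<^sub>M count_space UNIV"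
  unfolding measurable_cong_sets[OF sets_traj refl] by (rule measurable_component_singleton) simp

text \<open>
  The coordinate is read off after restriction to the first \<open>t + 1\<close> times, where the projective
  limit coincides with the finite composition of kernels.
\<close>

lemma distr_traj_component:
  fixes M :: "('s::finite, 'o::finite, 'a::finite) pomdp"
  shows "distr (traj M b d) (count_space UNIV) (\<lambda>\<omega>. \<omega> t) = measure_pmf (stage_law M b d t)"
proof -
  let ?N = "\<lambda>_::nat. count_space (UNIV :: ('s \<times> 'o \<times> 'a) set)"
  let ?J = "{0..<Suc t}"
  interpret Ionescu_Tulcea "step_kernel M b d" ?N
    by (rule Ionescu_Tulcea_step_kernel)
  have comp: "(\<lambda>\<omega>. \<omega> t) \<in> PiM ?J ?N \<rightarrow>\<^sub>M count_space UNIV"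
    by (rule measurable_component_singleton) simp
  have restr: "(\<lambda>\<omega>. restrict \<omega> ?J) \<in> PF.lim \<rightarrow>\<^sub>M PiM ?J ?N"
    unfolding measurable_cong_sets[OF PF.sets_lim refl] by (rule measurable_restrict_subset) simp
  have start: "(\<lambda>_. undefined) \<in> space (PiM {0..<0::nat} ?N)"
    by (simp add: space_PiM)
  have up_to_J: "up_to ?J = Suc t"
    by (rule antisym) (simp_all add: up_to_iff_Ico up_to_less Suc_leI)
  have restrC: "(\<lambda>\<omega>. restrict \<omega> ?J) \<in> C 0 (Suc t) (\<lambda>_. undefined) \<rightarrow>\<^sub>M PiM ?J ?N"
    unfolding measurable_cong_sets[OF sets_C[OF start, of "Suc t"] refl]
    by (rule measurable_restrict_subset) simp
  have "distr (traj M b d) (count_space UNIV) (\<lambda>\<omega>. \<omega> t)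
      = distr (distr PF.lim (PiM ?J ?N) (\<lambda>\<omega>. restrict \<omega> ?J)) (count_space UNIV) (\<lambda>\<omega>. \<omega> t)"
    unfolding traj_def by (subst distr_distr[OF comp restr]) (simp add: comp_def)
  also have "\<dots> = distr (CI ?J) (count_space UNIV) (\<lambda>\<omega>. \<omega> t)"
    by (simp only: distr_lim[OF finite_atLeastLessThan])
  also have "\<dots> = distr (C 0 (Suc t) (\<lambda>_. undefined)) (count_space UNIV) (\<lambda>\<omega>. \<omega> t)"
    unfolding CI_def up_to_J by (subst distr_distr[OF comp restrC]) (simp add: comp_def)
  also have "\<dots> = measure_pmf (stage_law M b d t)" (is "distr ?C _ _ = _")
  proof (rule measure_eqI)
    fix A :: "('s \<times> 'o \<times> 'a) set"
    have compC: "(\<lambda>\<omega>. \<omega> t) \<in> ?C \<rightarrow>\<^sub>M count_space UNIV"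
      unfolding measurable_cong_sets[OF sets_C[OF start, of "Suc t"] refl] using comp by simp
    have "emeasure (distr ?C (count_space UNIV) (\<lambda>\<omega>. \<omega> t)) A
        = (\<integral>\<^sup>+x. indicator A x \<partial>distr ?C (count_space UNIV) (\<lambda>\<omega>. \<omega> t))"
      by simp
    also have "\<dots> = (\<integral>\<^sup>+\<omega>. indicator A (\<omega> t) \<partial>?C)"
      by (rule nn_integral_distr[OF compC]) simp
    also have "\<dots> = (\<integral>\<^sup>+\<omega>. indicator A (\<omega> t) \<partial>prefix_law M b d (Suc t))"
      by (rule nn_integral_Ionescu_Tulcea_C)
    also have "\<dots> = (\<integral>\<^sup>+x. indicator A x \<partial>stage_law M b d t)"
      by (simp only: stage_law_eq_map_prefix_law[symmetric] nn_integral_map_pmf)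
    finally show "emeasure (distr ?C (count_space UNIV) (\<lambda>\<omega>. \<omega> t)) A = emeasure (stage_law M b d t) A"
      by simp
  qed simp
  finally show ?thesis .
qed

lemma prob_space_traj:
  fixes M :: "('s::finite, 'o::finite, 'a::finite) pomdp"
  shows "prob_space (traj M b d)"
  by (rule prob_space_distrD[OF measurable_traj_component[of 0]])
     (simp add: distr_traj_component measure_pmf.prob_space_axioms)

lemma integral_traj_component:
  fixes M :: "('s::finite, 'o::finite, 'a::finite) pomdp" and g :: "'s \<times> 'o \<times> 'a \<Rightarrow> real"
  shows "integrable (traj M b d) (\<lambda>\<omega>. g (\<omega> t))"
    and "(\<integral>\<omega>. g (\<omega> t) \<partial>traj M b d) = (\<Sum>x\<in>UNIV. pmf (stage_law M b d t) x * g x)"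
proof -
  have "integrable (measure_pmf (stage_law M b d t)) g"
    by (rule integrable_measure_pmf_finite) simp
  then show "integrable (traj M b d) (\<lambda>\<omega>. g (\<omega> t))"
    unfolding distr_traj_component[symmetric]
    by (rule integrable_distr[OF measurable_traj_component])
  have "(\<integral>\<omega>. g (\<omega> t) \<partial>traj M b d) = (\<integral>x. g x \<partial>stage_law M b d t)"
    unfolding distr_traj_component[symmetric]
    by (rule integral_distr[OF measurable_traj_component, symmetric]) simp
  also have "\<dots> = (\<Sum>x\<in>UNIV. pmf (stage_law M b d t) x * g x)"
    by (subst integral_measure_pmf[of UNIV]) auto
  finally show "(\<integral>\<omega>. g (\<omega> t) \<partial>traj M b d) = (\<Sum>x\<in>UNIV. pmf (stage_law M b d t) x * g x)" .
qed

section \<open>Flows induced by decision rules\<close>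

definition stage_flow ::
  "('s, 'o, 'a) pomdp \<Rightarrow> 's pmf \<Rightarrow> ('s, 'o, 'a) decision_rule \<Rightarrow> nat \<Rightarrow> 's \<Rightarrow> 'o \<Rightarrow> 'a \<Rightarrow> real" where
  "stage_flow M b d t s y a = pmf (stage_law M b d t) (s, y, a)"

lemma sum_UNIV_triple:
  "(\<Sum>x\<in>(UNIV :: ('s::finite \<times> 'o::finite \<times> 'a::finite) set). f x)
     = (\<Sum>s\<in>UNIV. \<Sum>y\<in>UNIV. \<Sum>a\<in>UNIV. f (s, y, a))"
  by (simp add: sum.cartesian_product split_beta)

lemma pmf_step_pmf:
  fixes M :: "('s::finite, 'o::finite, 'a::finite) pomdp"
  shows "pmf (step_pmf M b d t \<omega>) (s, y, a) =
    pmf (if t = 0 then b else trans_prob M (state \<omega> (t - 1)) (action \<omega> (t - 1))) s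
      * pmf (obs_prob M s) y * pmf (d t \<omega> y) a"
proof -
  have act: "pmf (map_pmf (\<lambda>a. (s', y', a)) (d t \<omega> y')) (s, y, a)
      = (if s' = s \<and> y' = y then pmf (d t \<omega> y) a else 0)" for s' y'
  proof (cases "s' = s \<and> y' = y")
    case True
    have "inj (\<lambda>a. (s, y, a))" by (simp add: inj_on_def)
    from pmf_map_inj'[OF this, of "d t \<omega> y" a] True show ?thesis by simp
  next
    case False
    then have "(s, y, a) \<notin> set_pmf (map_pmf (\<lambda>a. (s', y', a)) (d t \<omega> y'))" by auto
    then have "pmf (map_pmf (\<lambda>a. (s', y', a)) (d t \<omega> y')) (s, y, a) = 0"
      by (simp only: set_pmf_iff not_not)
    with False show ?thesis by auto
  qed
  have "pmf (bind_pmf (obs_prob M s') (\<lambda>y'. map_pmf (\<lambda>a. (s', y', a)) (d t \<omega> y'))) (s, y, a)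
      = (if s' = s then pmf (obs_prob M s) y * pmf (d t \<omega> y) a else 0)" for s'
    by (cases "s' = s") (simp_all add: pmf_bind integral_measure_pmf[of UNIV] act
        if_distrib[of "\<lambda>x. _ * x"] cong: if_cong)
  then show ?thesis
    unfolding step_pmf_def pmf_bind[of _ _ "(s, y, a)"]
    by (simp add: integral_measure_pmf[of UNIV] if_distrib[of "\<lambda>x. _ * x"] mult.assoc cong: if_cong)
qed

lemma expectation_prefix_law_last:
  fixes M :: "('s::finite, 'o::finite, 'a::finite) pomdp" and g :: "'s \<times> 'o \<times> 'a \<Rightarrow> real"
  shows "(\<integral>\<omega>. g (\<omega> t) \<partial>prefix_law M b d (Suc t)) = (\<Sum>x\<in>UNIV. pmf (stage_law M b d t) x * g x)"
proof -
  have "(\<integral>\<omega>. g (\<omega> t) \<partial>prefix_law M b d (Suc t)) = (\<integral>x. g x \<partial>stage_law M b d t)"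
    unfolding stage_law_eq_map_prefix_law[symmetric] by (rule integral_map_pmf[symmetric])
  also have "\<dots> = (\<Sum>x\<in>UNIV. pmf (stage_law M b d t) x * g x)"
    by (subst integral_measure_pmf[of UNIV]) auto
  finally show ?thesis .
qed

lemma finite_set_prefix_law:
  fixes M :: "('s::finite, 'o::finite, 'a::finite) pomdp"
  shows "finite (set_pmf (prefix_law M b d n))"
  by (induction n) auto

lemma integrable_prefix_law:
  fixes M :: "('s::finite, 'o::finite, 'a::finite) pomdp" and g :: "_ \<Rightarrow> real"
  shows "integrable (measure_pmf (prefix_law M b d n)) g"
  by (rule integrable_measure_pmf_finite[OF finite_set_prefix_law])

text \<open>
  For \<open>t \<ge> 1\<close>, the probability that \<open>s'\<close> and \<open>a'\<close> occur at time \<open>t - 1\<close> and that action \<open>a\<close> is then chosen at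
  time \<open>t\<close> if the observation at time \<open>t\<close> is \<open>y\<close>. The new state does not enter: a decision rule
  sees the past and \<open>y\<close> only.
\<close>

definition past_choice ::
  "('s, 'o, 'a) pomdp \<Rightarrow> 's pmf \<Rightarrow> ('s, 'o, 'a) decision_rule \<Rightarrow> nat \<Rightarrow> 's \<Rightarrow> 'a \<Rightarrow> 'o \<Rightarrow> 'a \<Rightarrow> real" where
  "past_choice M b d t s' a' y a =
     (\<integral>\<omega>. of_bool (state \<omega> (t - 1) = s' \<and> action \<omega> (t - 1) = a') * pmf (d t \<omega> y) a \<partial>prefix_law M b d t)"

lemma past_choice_nonneg: "0 \<le> past_choice M b d t s' a' y a"
  unfolding past_choice_def by (rule Bochner_Integration.integral_nonneg) simp

lemma sum_past_choice:
  fixes M :: "('s::finite, 'o::finite, 'a::finite) pomdp"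
  shows "(\<Sum>a\<in>UNIV. past_choice M b d (Suc t) s' a' y a) = obs_marginal (stage_flow M b d t) s' a'"
proof -
  have "(\<Sum>a\<in>UNIV. past_choice M b d (Suc t) s' a' y a)
     = (\<integral>\<omega>. (\<Sum>a\<in>UNIV. of_bool (state \<omega> t = s' \<and> action \<omega> t = a') * pmf (d (Suc t) \<omega> y) a) \<partial>prefix_law M b d (Suc t))"
    unfolding past_choice_def by (subst Bochner_Integration.integral_sum) (auto intro: integrable_prefix_law simp del: prefix_law.simps)
  also have "\<dots> = (\<integral>\<omega>. of_bool (fst (\<omega> t) = s' \<and> snd (snd (\<omega> t)) = a') \<partial>prefix_law M b d (Suc t))"
    by (simp add: sum_distrib_left[symmetric] sum_pmf_eq_1 state_def action_def del: prefix_law.simps)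
  also have "\<dots> = (\<Sum>x\<in>UNIV. pmf (stage_law M b d t) x * of_bool (fst x = s' \<and> snd (snd x) = a'))"
    by (rule expectation_prefix_law_last)
  also have "\<dots> = obs_marginal (stage_flow M b d t) s' a'"
  proof -
    have "(\<Sum>s\<in>UNIV. \<Sum>y\<in>UNIV. \<Sum>a\<in>UNIV. pmf (stage_law M b d t) (s, y, a) * of_bool (s = s' \<and> a = a'))
      = (\<Sum>s\<in>UNIV. of_bool (s = s') * (\<Sum>y\<in>UNIV. \<Sum>a\<in>UNIV. of_bool (a = a') * pmf (stage_law M b d t) (s, y, a)))"
      by (simp only: sum_distrib_left of_bool_conj mult_ac)
    also have "\<dots> = (\<Sum>y\<in>UNIV. pmf (stage_law M b d t) (s', y, a'))"
      by simp
    finally show ?thesis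
      by (simp only: sum_UNIV_triple obs_marginal_def stage_flow_def fst_conv snd_conv)
  qed
  finally show ?thesis .
qed

text \<open>
  For \<open>t \<ge> 1\<close>, the joint probability of \<open>s'\<close>, \<open>a'\<close> at time \<open>t - 1\<close> and \<open>s\<close>, \<open>y\<close>, \<open>a\<close> at time \<open>t\<close>, written
  as a product in which only the first two factors depend on \<open>s\<close>. This factorization is the conditional
  independence of \<open>s\<close> and \<open>a\<close> given \<open>s'\<close>, \<open>a'\<close>, \<open>y\<close> that the additional constraints express.
\<close>

definition lagged_flow ::
  "('s, 'o, 'a) pomdp \<Rightarrow> 's pmf \<Rightarrow> ('s, 'o, 'a) decision_rule \<Rightarrow> nat \<Rightarrow> 's \<Rightarrow> 'a \<Rightarrow> 's \<Rightarrow> 'o \<Rightarrow> 'a \<Rightarrow> real" where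
  "lagged_flow M b d t s' a' s y a =
     pmf (obs_prob M s) y * pmf (trans_prob M s' a') s * past_choice M b d t s' a' y a"

lemma sum_lagged_flow:
  fixes M :: "('s::finite, 'o::finite, 'a::finite) pomdp"
  shows "(\<Sum>s'\<in>UNIV. \<Sum>a'\<in>UNIV. lagged_flow M b d (Suc t) s' a' s y a) = stage_flow M b d (Suc t) s y a"
proof -
  let ?L = "prefix_law M b d (Suc t)"
  let ?c = "\<lambda>s' a'. pmf (obs_prob M s) y * pmf (trans_prob M s' a') s"
  have "(\<Sum>s'\<in>UNIV. \<Sum>a'\<in>UNIV. lagged_flow M b d (Suc t) s' a' s y a)
     = (\<integral>\<omega>. (\<Sum>s'\<in>UNIV. \<Sum>a'\<in>UNIV. ?c s' a' * (of_bool (state \<omega> t = s' \<and> action \<omega> t = a') * pmf (d (Suc t) \<omega> y) a)) \<partial>?L)"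
    unfolding lagged_flow_def past_choice_def
    by (simp add: Bochner_Integration.integral_sum integrable_prefix_law del: prefix_law.simps)
  also have "\<dots> = (\<integral>\<omega>. pmf (step_pmf M b d (Suc t) \<omega>) (s, y, a) \<partial>?L)"
  proof (rule Bochner_Integration.integral_cong[OF refl])
    fix \<omega>
    have "(\<Sum>s'\<in>UNIV. \<Sum>a'\<in>UNIV. ?c s' a' * (of_bool (state \<omega> t = s' \<and> action \<omega> t = a') * pmf (d (Suc t) \<omega> y) a))
      = (\<Sum>s'\<in>UNIV. of_bool (state \<omega> t = s') * (\<Sum>a'\<in>UNIV. of_bool (action \<omega> t = a') * (?c s' a' * pmf (d (Suc t) \<omega> y) a)))"
      by (simp add: sum_distrib_left of_bool_conj mult_ac)
    also have "\<dots> = pmf (step_pmf M b d (Suc t) \<omega>) (s, y, a)"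
      by (simp add: pmf_step_pmf)
    finally show "(\<Sum>s'\<in>UNIV. \<Sum>a'\<in>UNIV. ?c s' a' * (of_bool (state \<omega> t = s' \<and> action \<omega> t = a') * pmf (d (Suc t) \<omega> y) a))
      = pmf (step_pmf M b d (Suc t) \<omega>) (s, y, a)" .
  qed
  also have "\<dots> = stage_flow M b d (Suc t) s y a"
    by (simp only: stage_flow_def stage_law_def pmf_bind)
  finally show ?thesis .
qed

lemma sum_actions_lagged_flow:
  fixes M :: "('s::finite, 'o::finite, 'a::finite) pomdp"
  shows "(\<Sum>a\<in>UNIV. lagged_flow M b d (Suc t) s' a' s y a)
    = pmf (obs_prob M s) y * pmf (trans_prob M s' a') s * obs_marginal (stage_flow M b d t) s' a'"
  unfolding lagged_flow_def sum_distrib_left[symmetric] sum_past_choice ..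

lemma flow_stage_flow:
  fixes M :: "('s::finite, 'o::finite, 'a::finite) pomdp"
  shows "flow M b (stage_flow M b d)"
  unfolding flow_def
proof (intro conjI allI)
  show "0 \<le> stage_flow M b d t s y a" for t s y a
    by (simp add: stage_flow_def)
  show "(\<Sum>a\<in>UNIV. stage_flow M b d 0 s y a) = pmf (obs_prob M s) y * pmf b s" for s y
    by (simp add: stage_flow_def stage_law_def bind_return_pmf pmf_step_pmf
        sum_distrib_left[symmetric] sum_pmf_eq_1)
  fix t s y
  have "(\<Sum>a\<in>UNIV. stage_flow M b d (Suc t) s y a)
    = (\<Sum>a\<in>UNIV. \<Sum>s'\<in>UNIV. \<Sum>a'\<in>UNIV. lagged_flow M b d (Suc t) s' a' s y a)"
    by (simp add: sum_lagged_flow)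
  also have "\<dots> = (\<Sum>s'\<in>UNIV. \<Sum>a\<in>UNIV. \<Sum>a'\<in>UNIV. lagged_flow M b d (Suc t) s' a' s y a)"
    by (rule sum.swap)
  also have "\<dots> = (\<Sum>s'\<in>UNIV. \<Sum>a'\<in>UNIV. \<Sum>a\<in>UNIV. lagged_flow M b d (Suc t) s' a' s y a)"
    by (intro sum.cong refl sum.swap)
  also have "\<dots> = pmf (obs_prob M s) y * next_state M (obs_marginal (stage_flow M b d t)) s"
    by (simp add: sum_actions_lagged_flow next_state_def sum_distrib_left mult.assoc)
  finally show "(\<Sum>a\<in>UNIV. stage_flow M b d (Suc t) s y a)
     = pmf (obs_prob M s) y * next_state M (obs_marginal (stage_flow M b d t)) s" .
qed

text \<open>
  Summing the factorization over the state leaves the factor \<open>past_choice\<close> times the denominator of the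
  posterior.
\<close>

lemma lagged_flow_posterior:
  fixes M :: "('s::finite, 'o::finite, 'a::finite) pomdp"
  shows "lagged_flow M b d t s' a' s y a
    = posterior_state M s' a' y s * (\<Sum>s''\<in>UNIV. lagged_flow M b d t s' a' s'' y a)"
proof -
  let ?w = "\<lambda>s. pmf (obs_prob M s) y * pmf (trans_prob M s' a') s"
  have sum: "(\<Sum>s''\<in>UNIV. lagged_flow M b d t s' a' s'' y a) = sum ?w UNIV * past_choice M b d t s' a' y a"
    by (simp add: lagged_flow_def sum_distrib_right)
  show ?thesis
  proof (cases "sum ?w UNIV = 0")
    case True
\<comment> \<open>With a vanishing denominator the weights vanish, so both sides are 0.\<close>
    then have "?w s = 0"
      by (subst (asm) sum_nonneg_eq_0_iff) auto
    then have "lagged_flow M b d t s' a' s y a = 0"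
      by (auto simp: lagged_flow_def)
    moreover have "(\<Sum>s''\<in>UNIV. lagged_flow M b d t s' a' s'' y a) = 0"
      unfolding sum True by simp
    ultimately show ?thesis
      by simp
  next
    case False
    then show ?thesis
      by (simp add: sum posterior_state_def) (simp add: lagged_flow_def)
  qed
qed

lemma cut_constraints_stage_flow:
  fixes M :: "('s::finite, 'o::finite, 'a::finite) pomdp"
  shows "cut_constraints M T (stage_flow M b d) (\<lambda>t. obs_marginal (stage_flow M b d t)) (lagged_flow M b d)"
  unfolding cut_constraints_def
proof (intro ballI conjI allI)
  fix t s' a' s y a assume "t \<in> {1..T}"
  then obtain k where t: "t = Suc k" by (cases t) auto
  show "0 \<le> lagged_flow M b d t s' a' s y a"
    by (simp add: lagged_flow_def past_choice_nonneg)
  show "(\<Sum>s'\<in>UNIV. \<Sum>a'\<in>UNIV. lagged_flow M b d t s' a' s y a) = stage_flow M b d t s y a"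
    by (simp add: t sum_lagged_flow)
  show "(\<Sum>a\<in>UNIV. lagged_flow M b d t s' a' s y a) = pmf (obs_prob M s) y
      * pmf (trans_prob M s' a') s * obs_marginal (stage_flow M b d (t - 1)) s' a'"
    by (simp add: t sum_actions_lagged_flow)
  show "lagged_flow M b d t s' a' s y a
    = posterior_state M s' a' y s * (\<Sum>s''\<in>UNIV. lagged_flow M b d t s' a' s'' y a)"
    by (rule lagged_flow_posterior)
qed

lemma lp_objective_stage_flow_le_z_Rc:
  fixes M :: "('s::finite, 'o::finite, 'a::finite) pomdp"
  assumes \<gamma>: "0 \<le> discount M" "discount M < 1"
  shows "lp_objective M T (\<lambda>t. obs_marginal (stage_flow M b d t)) \<le> z_Rc M T b"
  by (rule z_Rc_ge[OF \<gamma> flow_relaxation_feasible[OF flow_stage_flow] cut_constraints_stage_flow])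

lemma expected_reward_stage_flow:
  fixes M :: "('s::finite, 'o::finite, 'a::finite) pomdp"
  shows "(\<integral>\<omega>. reward M (state \<omega> t) (action \<omega> t) \<partial>traj M b d)
    = expected_reward M (obs_marginal (stage_flow M b d t))"
proof -
  have "(\<integral>\<omega>. reward M (state \<omega> t) (action \<omega> t) \<partial>traj M b d)
     = (\<Sum>s\<in>UNIV. \<Sum>y\<in>UNIV. \<Sum>a\<in>UNIV. stage_flow M b d t s y a * reward M s a)"
    unfolding state_def action_def
    by (subst integral_traj_component(2)[where g="\<lambda>x. reward M (fst x) (snd (snd x))"])
       (simp add: sum_UNIV_triple stage_flow_def)
  also have "\<dots> = (\<Sum>s\<in>UNIV. \<Sum>a\<in>UNIV. \<Sum>y\<in>UNIV. stage_flow M b d t s y a * reward M s a)"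
    by (intro sum.cong refl sum.swap)
  finally show ?thesis
    by (simp add: expected_reward_def obs_marginal_def sum_distrib_right)
qed

text \<open>
  Stage rewards are bounded uniformly, so the geometric series justifies exchanging expectation and
  summation.
\<close>

lemma discounted_reward_sums:
  fixes M :: "('s::finite, 'o::finite, 'a::finite) pomdp"
  assumes \<gamma>: "0 \<le> discount M" "discount M < 1"
  shows "(\<lambda>t. discount M ^ t * expected_reward M (obs_marginal (stage_flow M b d t)))
    sums discounted_reward M b d"
proof -
  interpret prob_space "traj M b d" by (rule prob_space_traj)
  define R where "R = (\<Sum>s\<in>UNIV. \<Sum>a\<in>UNIV. \<bar>reward M s a\<bar>)"
  have R: "\<bar>reward M s a\<bar> \<le> R" for s a
  proof -
    have "\<bar>reward M s a\<bar> \<le> (\<Sum>a\<in>UNIV. \<bar>reward M s a\<bar>)"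
      by (rule member_le_sum) auto
    also have "\<dots> \<le> R"
      unfolding R_def by (rule member_le_sum) (auto intro: sum_nonneg)
    finally show ?thesis .
  qed
  let ?f = "\<lambda>t \<omega>. discount M ^ t * reward M (state \<omega> t) (action \<omega> t)"
  have int: "integrable (traj M b d) (?f t)" for t
    unfolding state_def action_def
    by (rule integral_traj_component(1)[where g="\<lambda>x. discount M ^ t * reward M (fst x) (snd (snd x))"])
  have bound: "norm (?f t \<omega>) \<le> discount M ^ t * R" for t \<omega>
    using \<gamma>(1) by (simp add: abs_mult mult_left_mono R)
  have summable_R: "summable (\<lambda>t. discount M ^ t * R)"
    using \<gamma> by (intro summable_mult2 summable_geometric) auto
  have "(\<lambda>t. \<integral>\<omega>. ?f t \<omega> \<partial>traj M b d) sums (\<integral>\<omega>. (\<Sum>t. ?f t \<omega>) \<partial>traj M b d)"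
  proof (rule sums_integral[OF int])
    show "AE \<omega> in traj M b d. summable (\<lambda>t. norm (?f t \<omega>))"
      using bound by (intro AE_I2 summable_comparison_test'[OF summable_R, of 0]) simp
    have "(\<integral>\<omega>. norm (?f t \<omega>) \<partial>traj M b d) \<le> discount M ^ t * R" for t
      using int bound by (intro integral_le_const integrable_norm AE_I2)
    then show "summable (\<lambda>t. \<integral>\<omega>. norm (?f t \<omega>) \<partial>traj M b d)"
      by (intro summable_comparison_test'[OF summable_R, of 0]) simp
  qed
  then show ?thesis
    by (simp add: discounted_reward_def expected_reward_stage_flow)
qed

text \<open>
  Along a flow the objective decreases with the horizon and converges to the infinite-horizon reward,
  because the terminal term is bounded by a multiple of \<open>discount M ^ Suc n\<close>. Hence every
  horizon gives an upper bound.
\<close>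

lemma discounted_reward_le_objective:
  fixes M :: "('s::finite, 'o::finite, 'a::finite) pomdp"
  assumes \<gamma>: "0 \<le> discount M" "discount M < 1"
  shows "discounted_reward M b d \<le> lp_objective M T (\<lambda>t. obs_marginal (stage_flow M b d t))"
proof -
  define m where "m t = obs_marginal (stage_flow M b d t)" for t
  define C where "C = (\<Sum>s\<in>UNIV. \<bar>v_MDP M s\<bar>)"
  note fl = flow_stage_flow[of M b d]
  have m_nonneg: "0 \<le> m t s a" for t s a
    by (simp add: m_def obs_marginal_def stage_flow_def sum_nonneg)
  define V where "V n = (\<Sum>s\<in>UNIV. next_state M (m n) s * v_MDP M s)" for n
  have V_bound: "\<bar>V n\<bar> \<le> C" for n
  proof -
    have nonneg: "0 \<le> next_state M (m n) s" for s
      by (simp add: next_state_def sum_nonneg m_nonneg)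
    have "next_state M (m n) s = (\<Sum>a\<in>UNIV. m (Suc n) s a)" for s
      using flow_Suc[OF fl] by (simp add: m_def)
    then have "(\<Sum>s\<in>UNIV. next_state M (m n) s) = 1"
      using flow_total[OF fl, of "Suc n"] by (simp add: m_def)
    moreover have "next_state M (m n) s \<le> (\<Sum>s\<in>UNIV. next_state M (m n) s)" for s
      by (rule member_le_sum) (auto simp: nonneg)
    ultimately have "next_state M (m n) s \<le> 1" for s
      by simp
    then have "\<bar>next_state M (m n) s * v_MDP M s\<bar> \<le> \<bar>v_MDP M s\<bar>" for s
      using nonneg[of s] by (simp add: abs_mult mult_left_le_one_le)
    then show ?thesis
      unfolding V_def C_def by (intro order_trans[OF sum_abs] sum_mono)
  qed
  have "(\<lambda>n. discount M ^ Suc n * C) \<longlonglongrightarrow> 0 * C"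
    using \<gamma> by (intro tendsto_mult tendsto_const LIMSEQ_Suc LIMSEQ_power_zero) auto
  moreover have "norm (discount M ^ Suc n * V n) \<le> discount M ^ Suc n * C" for n
    using V_bound \<gamma>(1) by (simp add: abs_mult mult_left_mono del: power_Suc)
  ultimately have tail: "(\<lambda>n. discount M ^ Suc n * V n) \<longlonglongrightarrow> 0"
    unfolding mult_zero_left by (rule Lim_null_comparison[OF always_eventually[OF allI], rotated])
  have "(\<lambda>n. \<Sum>t\<le>n. discount M ^ t * expected_reward M (m t)) \<longlonglongrightarrow> discounted_reward M b d"
    using discounted_reward_sums[OF \<gamma>, of b d] by (simp add: sums_def_le m_def)
  then have "(\<lambda>n. lp_objective M n m) \<longlonglongrightarrow> discounted_reward M b d"
    using tendsto_add[OF _ tail] unfolding lp_objective_eq V_def by fastforce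
  moreover have "decseq (\<lambda>n. lp_objective M n m)"
  proof (rule decseq_SucI)
    show "lp_objective M (Suc n) m \<le> lp_objective M n m" for n
      by (rule lp_objective_Suc_le[OF \<gamma>]) (use m_nonneg flow_Suc[OF fl] in \<open>simp_all add: m_def\<close>)
  qed
  ultimately have "discounted_reward M b d \<le> lp_objective M T m"
    using decseq_ge by blast
  then show ?thesis
    by (simp add: m_def[abs_def])
qed

section \<open>Comparison of the values\<close>

theorem theorem6:
  fixes M :: "('s::finite, 'o::finite, 'a::finite) pomdp" and b :: "'s pmf" and T T' :: nat
  assumes "0 \<le> discount M" and "discount M < 1"
  shows "(\<forall>\<sigma>. SMF_selection M T \<sigma> \<longrightarrow> v_SMF M \<sigma> b \<le> v_star M b) \<and>
         v_star M b \<le> z_Rc M T' b \<and>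
         z_Rc M T' b \<le> z_R M T' b \<and>
         z_Rc M (T + 1) b \<le> z_Rc M T b \<and>
         z_R M T b = z_R M 0 b"
proof (intro conjI allI impI)
\<comment> \<open>Decision rules depend on the past and the current observation, so every history-dependent policy
yields a point that satisfies all constraints.\<close>
  have policy_le: "policy_value M \<pi> b \<le> z_Rc M n b" for \<pi> n
    unfolding policy_value_def
    using discounted_reward_le_objective[OF assms] lp_objective_stage_flow_le_z_Rc[OF assms]
    by (rule order_trans)
  show "v_SMF M \<sigma> b \<le> v_star M b" for \<sigma>
    unfolding v_SMF_def v_star_def
  proof (rule cSUP_upper)
    show "bdd_above (range (\<lambda>\<pi>. policy_value M \<pi> b))"
      by (rule bdd_aboveI2) (rule policy_le[of _ 0])
  qed simp
  show "v_star M b \<le> z_Rc M T' b"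
    unfolding v_star_def using policy_le by (intro cSUP_least) auto
  have Rc_le: "z_Rc M n b \<le> x" if "\<And>\<mu>S \<mu>SOA \<mu>SA \<delta> \<nu>. relaxation_feasible M n b \<mu>S \<mu>SOA \<mu>SA \<delta> \<Longrightarrow>
      cut_constraints M n \<mu>SOA \<mu>SA \<nu> \<Longrightarrow> lp_objective M n \<mu>SA \<le> x" for n x
    unfolding z_Rc_def
  proof (rule cSup_least)
    show "{lp_objective M n \<mu>SA | \<mu>S \<mu>SOA \<mu>SA \<delta> \<nu>.
       relaxation_feasible M n b \<mu>S \<mu>SOA \<mu>SA \<delta> \<and> cut_constraints M n \<mu>SOA \<mu>SA \<nu>} \<noteq> {}"
      using flow_relaxation_feasible[OF flow_stage_flow, of M n b] cut_constraints_stage_flow[of M n b] by blast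
  qed (use that in blast)
  show "z_Rc M T' b \<le> z_R M T' b"
    using feasible_objective_le[OF assms] by (intro Rc_le) (simp add: z_R_eq[OF assms])
  show "z_Rc M (T + 1) b \<le> z_Rc M T b"
  proof (rule Rc_le)
    fix \<mu>S \<mu>SOA \<mu>SA \<delta> \<nu>
    assume feas: "relaxation_feasible M (T + 1) b \<mu>S \<mu>SOA \<mu>SA \<delta>"
      and cut: "cut_constraints M (T + 1) \<mu>SOA \<mu>SA \<nu>"
    have "lp_objective M (T + 1) \<mu>SA \<le> lp_objective M T \<mu>SA"
      using feasible_objective_Suc_le[OF assms] feas by simp
    also have "\<dots> \<le> z_Rc M T b"
    proof (rule z_Rc_ge[OF assms])
      show "relaxation_feasible M T b \<mu>S \<mu>SOA \<mu>SA \<delta>"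
        using feas by (simp add: relaxation_feasible_Suc)
      show "cut_constraints M T \<mu>SOA \<mu>SA \<nu>"
        unfolding cut_constraints_def
        by (intro ballI bspec[OF cut[unfolded cut_constraints_def]]) simp
    qed
    finally show "lp_objective M (T + 1) \<mu>SA \<le> z_Rc M T b" .
  qed
  show "z_R M T b = z_R M 0 b"
    by (simp add: z_R_eq[OF assms])
qed

end
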